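(* Let $\mathcal{M}$ be a $K$-causal spacetime without boundary. Then for every $p\in\mathcal{M}$ the topological boundary (frontier) $\mathrm{Fr}(K^+(p))$ of $K^+(p)$ in $\mathcal{M}$ equals the causal (order-theoretic) boundary $\partial K^+(p)$ of $K^+(p)$.
   Context: A spacetime is a smooth connected Hausdorff paracompact manifold $\mathcal{M}$ (of arbitrary dimension $\ge 2$) with a smooth time-oriented Lorentzian metric. $I^+(p)$ is the set of events accessible from $p$ by future-directed timelike curves starting from $p$, and $I^+$, regarded as a relation, is $\{(p,q): q\in I^+(p)\}\subseteq\mathcal{M}\times\mathcal{M}$. The relation $K^+$, also written $\prec$, is the smallest relation on $\mathcal{M}$ that contains $I^+$, is transitive, and is topologically closed as a subset of $\mathcal{M}\times\mathcal{M}$ (i.e. the intersection of all closed transitive relations containing $I^+$). $K^+(p)=\{q\in\mathcal{M}: p\prec q\}$. The spacetime $\mathcal{M}$ is $K$-causal iff $\prec$ is a (reflexive) partial order on $\mathcal{M}$, i.e. $\prec$ is antisymmetric. The causal (order-theoretic) boundary $\partial K^+(p)$ is the set of all $x\in K^+(p)$ for which there is an increasing sequence $y_1\prec y_2\prec y_3\prec\cdots$ of points, all belonging to the complement of $K^+(p)$, such that $x=\sup\{y_i\}$, the supremum (least upper bound) being taken in $\mathcal{M}$ with respect to $\prec$. *)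

theory Defs
  imports "HOL-Analysis.Analysis"
begin

section \<open>Smooth manifolds\<close>

text \<open>
  Manifolds are carried by an abstract topology and modelled on a Euclidean space \<open>'e\<close>, whose
  dimension is the dimension of the manifold. A smooth structure is given by an atlas, which need
  not be maximal. All charts have open images in \<open>'e\<close>, so the manifolds have no boundary.
\<close>

definition paracompact_space :: "'a topology \<Rightarrow> bool" where
  "paracompact_space X \<longleftrightarrow>
     (\<forall>\<U>. (\<forall>U\<in>\<U>. openin X U) \<and> \<Union>\<U> = topspace X \<longrightarrow>
       (\<exists>\<V>. (\<forall>V\<in>\<V>. openin X V) \<and> \<Union>\<V> = topspace X \<and>
            (\<forall>V\<in>\<V>. \<exists>U\<in>\<U>. V \<subseteq> U) \<and> locally_finite_in X \<V>))"

text \<open>Being \<open>k\<close> times continuously differentiable; meaningful for open \<open>S\<close> only, as the derivatives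
  are two-sided.\<close>

fun Ck_on :: "nat \<Rightarrow> 'b::real_normed_vector set \<Rightarrow> ('b \<Rightarrow> 'c::real_normed_vector) \<Rightarrow> bool" where
  "Ck_on 0 S f \<longleftrightarrow> continuous_on S f"
| "Ck_on (Suc k) S f \<longleftrightarrow>
     (\<forall>x\<in>S. f differentiable (at x)) \<and> (\<forall>v. Ck_on k S (\<lambda>x. frechet_derivative f (at x) v))"

definition smooth_on :: "'b::real_normed_vector set \<Rightarrow> ('b \<Rightarrow> 'c::real_normed_vector) \<Rightarrow> bool" where
  "smooth_on S f \<longleftrightarrow> (\<forall>k. Ck_on k S f)"

text \<open>A chart is a domain together with a coordinate map, whose values outside the domain are
  irrelevant.\<close>

type_synonym ('a, 'e) chart = "'a set \<times> ('a \<Rightarrow> 'e)"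

definition chart_on :: "'a topology \<Rightarrow> ('a, 'e::euclidean_space) chart \<Rightarrow> bool" where
  "chart_on X c \<longleftrightarrow> openin X (fst c) \<and> open (snd c ` fst c) \<and>
     homeomorphic_map (subtopology X (fst c)) (top_of_set (snd c ` fst c)) (snd c)"

definition transition :: "('a, 'e) chart \<Rightarrow> ('a, 'e) chart \<Rightarrow> 'e \<Rightarrow> 'e" where
  "transition c d = snd d \<circ> inv_into (fst c) (snd c)"

definition smooth_atlas :: "'a topology \<Rightarrow> ('a, 'e::euclidean_space) chart set \<Rightarrow> bool" where
  "smooth_atlas X A \<longleftrightarrow>
     (\<forall>c\<in>A. chart_on X c) \<and> \<Union>(fst ` A) = topspace X \<and>
     (\<forall>c\<in>A. \<forall>d\<in>A. smooth_on (snd c ` (fst c \<inter> fst d)) (transition c d))"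

definition smooth_manifold :: "'a topology \<Rightarrow> ('a, 'e::euclidean_space) chart set \<Rightarrow> bool" where
  "smooth_manifold X A \<longleftrightarrow> Hausdorff_space X \<and> paracompact_space X \<and> smooth_atlas X A"


section \<open>Spacetimes\<close>

text \<open>
  Tensor fields are given by their coordinate expressions, one for each chart of the atlas, subject
  to the usual transformation law: a vector field assigns to a chart \<open>c\<close> and a point \<open>x\<close> in its
  domain the components in \<open>'e\<close> of the vector at \<open>x\<close>; a covariant 2-tensor field assigns to them a
  bilinear form on \<open>'e\<close>. Likewise a single tangent vector at \<open>x\<close> is represented by its components
  in a chart around \<open>x\<close>. The values for charts not around \<open>x\<close> are irrelevant.
\<close>

definition coord_change :: "('a, 'e::euclidean_space) chart \<Rightarrow> ('a, 'e) chart \<Rightarrow> 'a \<Rightarrow> 'e \<Rightarrow> 'e" where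
  "coord_change c d x = frechet_derivative (transition c d) (at (snd c x))"

text \<open>Symmetric bilinear forms of signature \<open>(-,+,\<dots>,+)\<close>: there is an orthonormal basis \<open>E\<close> with
  exactly one timelike member \<open>e0\<close>.\<close>

definition lorentzian_form :: "('e::euclidean_space \<Rightarrow> 'e \<Rightarrow> real) \<Rightarrow> bool" where
  "lorentzian_form B \<longleftrightarrow> bilinear B \<and> (\<forall>u v. B u v = B v u) \<and>
     (\<exists>E e0. independent E \<and> span E = UNIV \<and> e0 \<in> E \<and>
        B e0 e0 = -1 \<and> (\<forall>e\<in>E - {e0}. B e e = 1) \<and>
        (\<forall>e\<in>E. \<forall>f\<in>E. e \<noteq> f \<longrightarrow> B e f = 0))"

definition lorentzian_metric ::
    "('a, 'e::euclidean_space) chart set \<Rightarrow> (('a, 'e) chart \<Rightarrow> 'a \<Rightarrow> 'e \<Rightarrow> 'e \<Rightarrow> real) \<Rightarrow> bool" where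
  "lorentzian_metric A g \<longleftrightarrow>
     (\<forall>c\<in>A. \<forall>x\<in>fst c. lorentzian_form (g c x)) \<and>
     (\<forall>c\<in>A. \<forall>u v. smooth_on (snd c ` fst c) (\<lambda>y. g c (inv_into (fst c) (snd c) y) u v)) \<and>
     (\<forall>c\<in>A. \<forall>d\<in>A. \<forall>x\<in>fst c \<inter> fst d. \<forall>u v.
        g c x u v = g d x (coord_change c d x u) (coord_change c d x v))"

text \<open>A time orientation is given by a continuous timelike vector field, which is declared to be
  future-directed.\<close>

definition time_orienting_field ::
    "'a topology \<Rightarrow> ('a, 'e::euclidean_space) chart set \<Rightarrow> (('a, 'e) chart \<Rightarrow> 'a \<Rightarrow> 'e \<Rightarrow> 'e \<Rightarrow> real) \<Rightarrow>
     (('a, 'e) chart \<Rightarrow> 'a \<Rightarrow> 'e) \<Rightarrow> bool" where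
  "time_orienting_field X A g T \<longleftrightarrow>
     (\<forall>c\<in>A. continuous_map (subtopology X (fst c)) euclidean (T c)) \<and>
     (\<forall>c\<in>A. \<forall>d\<in>A. \<forall>x\<in>fst c \<inter> fst d. T d x = coord_change c d x (T c x)) \<and>
     (\<forall>c\<in>A. \<forall>x\<in>fst c. g c x (T c x) (T c x) < 0)"

record ('a, 'e) spacetime =
  events :: "'a topology"
  atlas :: "('a, 'e) chart set"
  metric :: "('a, 'e) chart \<Rightarrow> 'a \<Rightarrow> 'e \<Rightarrow> 'e \<Rightarrow> real"
  time_field :: "('a, 'e) chart \<Rightarrow> 'a \<Rightarrow> 'e"

definition is_spacetime :: "('a, 'e::euclidean_space) spacetime \<Rightarrow> bool" where
  "is_spacetime M \<longleftrightarrow>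
     DIM('e) \<ge> 2 \<and> smooth_manifold (events M) (atlas M) \<and> connected_space (events M) \<and>
     lorentzian_metric (atlas M) (metric M) \<and>
     time_orienting_field (events M) (atlas M) (metric M) (time_field M)"


section \<open>Chronological relation and \<open>K\<close>-causality\<close>

definition future_timelike ::
    "('a, 'e::euclidean_space) spacetime \<Rightarrow> ('a, 'e) chart \<Rightarrow> 'a \<Rightarrow> 'e \<Rightarrow> bool" where
  "future_timelike M c x v \<longleftrightarrow> metric M c x v v < 0 \<and> metric M c x (time_field M c x) v < 0"

text \<open>Continuously differentiable on the closed interval (one-sidedly at its ends), with
  future-directed timelike velocity throughout.\<close>

definition timelike_segment ::
    "('a, 'e::euclidean_space) spacetime \<Rightarrow> (real \<Rightarrow> 'a) \<Rightarrow> real \<Rightarrow> real \<Rightarrow> bool" where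
  "timelike_segment M \<gamma> a b \<longleftrightarrow>
     (\<forall>c\<in>atlas M. \<exists>\<gamma>'.
        continuous_on {t\<in>{a..b}. \<gamma> t \<in> fst c} \<gamma>' \<and>
        (\<forall>t\<in>{a..b}. \<gamma> t \<in> fst c \<longrightarrow>
           (snd c \<circ> \<gamma> has_vector_derivative \<gamma>' t) (at t within {a..b}) \<and>
           future_timelike M c (\<gamma> t) (\<gamma>' t)))"

text \<open>Future-directed timelike curves are piecewise continuously differentiable. At a break point
  both one-sided velocities are future-directed timelike.\<close>

definition timelike_curve ::
    "('a, 'e::euclidean_space) spacetime \<Rightarrow> (real \<Rightarrow> 'a) \<Rightarrow> real \<Rightarrow> real \<Rightarrow> bool" where
  "timelike_curve M \<gamma> a b \<longleftrightarrow>
     a < b \<and> continuous_map (top_of_set {a..b}) (events M) \<gamma> \<and>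
     (\<exists>(n::nat) s. s 0 = a \<and> s n = b \<and>
        (\<forall>i<n. s i < s (Suc i) \<and> timelike_segment M \<gamma> (s i) (s (Suc i))))"

definition I_plus :: "('a, 'e::euclidean_space) spacetime \<Rightarrow> ('a \<times> 'a) set" where
  "I_plus M = {(p, q). \<exists>\<gamma> a b. timelike_curve M \<gamma> a b \<and> \<gamma> a = p \<and> \<gamma> b = q}"

definition K_plus :: "('a, 'e::euclidean_space) spacetime \<Rightarrow> ('a \<times> 'a) set" where
  "K_plus M =
     \<Inter>{R. I_plus M \<subseteq> R \<and> trans R \<and> closedin (prod_topology (events M) (events M)) R}"

definition K_causal :: "('a, 'e::euclidean_space) spacetime \<Rightarrow> bool" where
  "K_causal M \<longleftrightarrow> partial_order_on (topspace (events M)) (K_plus M)"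

definition K_future :: "('a, 'e::euclidean_space) spacetime \<Rightarrow> 'a \<Rightarrow> 'a set" where
  "K_future M p = {q. (p, q) \<in> K_plus M}"

text \<open>\<open>x\<close> is a least upper bound of \<open>S\<close> in \<open>A\<close> with respect to the order \<open>r\<close>.\<close>

definition is_sup_in :: "'a set \<Rightarrow> ('a \<times> 'a) set \<Rightarrow> 'a set \<Rightarrow> 'a \<Rightarrow> bool" where
  "is_sup_in A r S x \<longleftrightarrow> x \<in> A \<and> (\<forall>y\<in>S. (y, x) \<in> r) \<and>
     (\<forall>z\<in>A. (\<forall>y\<in>S. (y, z) \<in> r) \<longrightarrow> (x, z) \<in> r)"

definition causal_boundary :: "('a, 'e::euclidean_space) spacetime \<Rightarrow> 'a \<Rightarrow> 'a set" where
  "causal_boundary M p =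
     {x \<in> K_future M p. \<exists>y :: nat \<Rightarrow> 'a.
        (\<forall>i. y i \<in> topspace (events M) - K_future M p) \<and>
        (\<forall>i. (y i, y (Suc i)) \<in> K_plus M) \<and>
        is_sup_in (topspace (events M)) (K_plus M) (range y) x}"

end

theory Submission
  imports Defs
begin

text \<open>
  Near a frontier point \<open>x\<close> of \<open>K_future M p\<close>, take a sequence along a straight timelike coordinate line
  ending at \<open>x\<close>. Each of its points chronologically precedes a neighbourhood of \<open>x\<close>, so it cannot lie in
  \<open>K_future M p\<close>; closedness of \<open>K_plus M\<close> makes the limit \<open>x\<close> the supremum. Conversely, an increasing
  sequence with supremum \<open>x\<close> accumulates topologically at \<open>x\<close>: a \<open>K\<close>-relation that enters a neighbourhood
  with compact frontier factors through the frontier, so a sequence avoiding the neighbourhood would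
  have an upper bound strictly below \<open>x\<close>.
\<close>

section \<open>Charts\<close>

text \<open>\<open>homeomorphic_map\<close> yields only some inverse \<open>g\<close>. It makes the
  coordinate map injective on the domain, so \<open>inv_into\<close> agrees with \<open>g\<close> on
  the image; \<open>inv_into\<close> is the inverse that occurs in \<open>transition\<close> and in
  the smoothness of the metric.\<close>

lemma chart_on_homeomorphic_maps:
  assumes "chart_on X c"
  shows "homeomorphic_maps (subtopology X (fst c)) (top_of_set (snd c ` fst c)) (snd c)
    (inv_into (fst c) (snd c))"
proof -
  have hom: "homeomorphic_map (subtopology X (fst c)) (top_of_set (snd c ` fst c)) (snd c)"
    and sub: "fst c \<subseteq> topspace X"
    using assms openin_subset by (auto simp: chart_on_def)
  then obtain g where g: "homeomorphic_maps (subtopology X (fst c)) (top_of_set (snd c ` fst c)) (snd c) g"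
    by (auto simp: homeomorphic_map_maps)
  have gi: "g (snd c x) = x" if "x \<in> fst c" for x
    using g that sub by (auto simp: homeomorphic_maps_def)
  then have inj: "inj_on (snd c) (fst c)"
    by (metis inj_onI)
  have "inv_into (fst c) (snd c) y = g y" if "y \<in> snd c ` fst c" for y
    using that gi inj by auto
  then show ?thesis
    using g by (elim homeomorphic_maps_eq) auto
qed

lemma chart_on_inverse [simp]:
  assumes "chart_on X c" and "x \<in> fst c"
  shows "inv_into (fst c) (snd c) (snd c x) = x"
proof -
  have "fst c \<subseteq> topspace X"
    using assms openin_subset by (auto simp: chart_on_def)
  then show ?thesis
    using chart_on_homeomorphic_maps[OF assms(1)] assms(2) by (auto simp: homeomorphic_maps_def)
qed

lemma chart_on_continuous_inverse:
  assumes "chart_on X c"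
  shows "continuous_map (top_of_set (snd c ` fst c)) X (inv_into (fst c) (snd c))"
  using chart_on_homeomorphic_maps[OF assms]
  by (auto simp: homeomorphic_maps_def continuous_map_in_subtopology)

lemma chart_on_open_image_inverse:
  assumes "chart_on X c" and "open B" and "B \<subseteq> snd c ` fst c"
  shows "openin X (inv_into (fst c) (snd c) ` B)"
proof -
  have "open_map (top_of_set (snd c ` fst c)) (subtopology X (fst c)) (inv_into (fst c) (snd c))"
    using chart_on_homeomorphic_maps[OF assms(1)]
    by (simp add: homeomorphic_maps_map homeomorphic_imp_open_map)
  moreover have "openin (top_of_set (snd c ` fst c)) B"
    using assms by (simp add: open_openin_trans open_subset)
  ultimately have "openin (subtopology X (fst c)) (inv_into (fst c) (snd c) ` B)"
    by (simp add: open_map_def)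
  then show ?thesis
    using assms(1) chart_on_def openin_trans_full by blast
qed

lemma chart_on_open_image:
  assumes "chart_on X c" and "openin X V" and "V \<subseteq> fst c"
  shows "open (snd c ` V)"
proof -
  have "open_map (subtopology X (fst c)) (top_of_set (snd c ` fst c)) (snd c)"
    using assms(1) by (simp add: chart_on_def homeomorphic_imp_open_map)
  moreover have "openin (subtopology X (fst c)) V"
    using assms openin_subset_topspace_eq by (metis inf.absorb2 openin_subtopology_Int2)
  ultimately have "openin (top_of_set (snd c ` fst c)) (snd c ` V)"
    by (simp add: open_map_def)
  then show ?thesis
    using assms(1) by (auto simp: chart_on_def openin_open_eq)
qed

lemma spacetime_chart_on:
  "is_spacetime M \<Longrightarrow> c \<in> atlas M \<Longrightarrow> chart_on (events M) c"
  by (simp add: is_spacetime_def smooth_manifold_def smooth_atlas_def)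

lemma spacetime_chart_around:
  assumes "is_spacetime M" and "x \<in> topspace (events M)"
  obtains c where "c \<in> atlas M" and "x \<in> fst c" and "chart_on (events M) c"
proof -
  have "\<Union>(fst ` atlas M) = topspace (events M)"
    using assms(1) by (simp add: is_spacetime_def smooth_manifold_def smooth_atlas_def)
  then show thesis
    using assms spacetime_chart_on that by (metis UN_E)
qed

text \<open>Take a small open coordinate ball. The image of the closed ball is compact, hence closed
  by the Hausdorff property, so it contains the frontier of the image of the open ball as a closed
  subset.\<close>

lemma spacetime_open_nbhd_compact_frontier:
  fixes M :: "('a, 'e::euclidean_space) spacetime"
  assumes M: "is_spacetime M" and U: "openin (events M) U" and x: "x \<in> U"
  obtains W where "openin (events M) W" and "x \<in> W" and "W \<subseteq> U"
    and "compactin (events M) (events M frontier_of W)"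
proof -
  have "x \<in> topspace (events M)"
    using U x openin_subset by blast
  then obtain c where c: "c \<in> atlas M" "x \<in> fst c" and ch: "chart_on (events M) c"
    using spacetime_chart_around[OF M] by metis
  let ?h = "inv_into (fst c) (snd c)"
  have "openin (events M) (fst c \<inter> U)"
    using ch U by (simp add: chart_on_def openin_Int)
  then have "open (snd c ` (fst c \<inter> U))"
    using ch by (simp add: chart_on_open_image)
  then obtain r where r: "r > 0" "cball (snd c x) r \<subseteq> snd c ` (fst c \<inter> U)"
    using c x unfolding open_contains_cball by blast
  have sub: "cball (snd c x) r \<subseteq> snd c ` fst c"
    using r by blast
  have inU: "?h ` cball (snd c x) r \<subseteq> U"
  proof
    fix q assume "q \<in> ?h ` cball (snd c x) r"
    then obtain y where "y \<in> fst c \<inter> U" "q = ?h (snd c y)"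
      using r(2) by blast
    then show "q \<in> U"
      using chart_on_inverse[OF ch] by simp
  qed
  have "compactin (top_of_set (snd c ` fst c)) (cball (snd c x) r)"
    using sub by (simp add: compactin_subtopology)
  then have comp: "compactin (events M) (?h ` cball (snd c x) r)"
    using chart_on_continuous_inverse[OF ch] image_compactin by blast
  have "Hausdorff_space (events M)"
    using M by (simp add: is_spacetime_def smooth_manifold_def)
  then have closed: "closedin (events M) (?h ` cball (snd c x) r)"
    using comp compactin_imp_closedin by blast
  have "events M closure_of (?h ` ball (snd c x) r) \<subseteq> ?h ` cball (snd c x) r"
    using closed by (intro closure_of_minimal image_mono ball_subset_cball)
  then have "events M frontier_of (?h ` ball (snd c x) r) \<subseteq> ?h ` cball (snd c x) r"
    unfolding frontier_of_def by blast
  then have "compactin (events M) (events M frontier_of (?h ` ball (snd c x) r))"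
    using closed_compactin[OF comp] closedin_frontier_of by blast
  moreover have "openin (events M) (?h ` ball (snd c x) r)"
    using sub ball_subset_cball by (intro chart_on_open_image_inverse[OF ch] open_ball) blast
  moreover have "x \<in> ?h ` ball (snd c x) r"
    using r(1) chart_on_inverse[OF ch c(2)] by (intro image_eqI[of _ _ "snd c x"]) simp_all
  moreover have "?h ` ball (snd c x) r \<subseteq> U"
    using inU ball_subset_cball by blast
  ultimately show thesis
    using that by blast
qed


section \<open>Chronology near a point\<close>

lemma bilinear_expand_Basis:
  fixes B :: "'e::euclidean_space \<Rightarrow> 'e \<Rightarrow> real"
  assumes "bilinear B"
  shows "B u v = (\<Sum>i\<in>Basis. \<Sum>j\<in>Basis. (u \<bullet> i) * (v \<bullet> j) * B i j)"
proof -
  have "B u v = B (\<Sum>i\<in>Basis. (u \<bullet> i) *\<^sub>R i) (\<Sum>j\<in>Basis. (v \<bullet> j) *\<^sub>R j)"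
    by (simp add: euclidean_representation)
  also have "\<dots> = (\<Sum>(i, j)\<in>Basis \<times> Basis. (u \<bullet> i) * (v \<bullet> j) * B i j)"
    using assms by (simp add: bilinear_sum bilinear_lmul bilinear_rmul mult.assoc)
  finally show ?thesis
    by (simp add: sum.cartesian_product)
qed

text \<open>The metric is known to be continuous only for fixed vectors. The basis expansion turns a
  pairing of varying vectors into a finite sum of products of continuous functions.\<close>

lemma continuous_on_bilinear_form:
  fixes B :: "'z::topological_space \<Rightarrow> 'e::euclidean_space \<Rightarrow> 'e \<Rightarrow> real"
  assumes "\<And>z. z \<in> S \<Longrightarrow> bilinear (B z)"
    and "\<And>u v. continuous_on S (\<lambda>z. B z u v)"
    and "continuous_on S f" and "continuous_on S g"
  shows "continuous_on S (\<lambda>z. B z (f z) (g z))"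
proof -
  have "continuous_on S (\<lambda>z. \<Sum>i\<in>Basis. \<Sum>j\<in>Basis. (f z \<bullet> i) * (g z \<bullet> j) * B z i j)"
    by (intro continuous_intros assms)
  then show ?thesis
    by (rule continuous_on_eq) (rule bilinear_expand_Basis[OF assms(1), symmetric])
qed

lemma open_negative_set:
  fixes f :: "'z::topological_space \<Rightarrow> real"
  assumes "open S" and "continuous_on S f"
  shows "open {z \<in> S. f z < 0}"
proof -
  have "open (S \<inter> f -` {..<0})"
    using assms by (intro continuous_open_preimage) auto
  moreover have "S \<inter> f -` {..<0} = {z \<in> S. f z < 0}"
    by auto
  ultimately show ?thesis
    by simp
qed

lemma spacetime_metric_bilinear:
  "is_spacetime M \<Longrightarrow> c \<in> atlas M \<Longrightarrow> x \<in> fst c \<Longrightarrow> bilinear (metric M c x)"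
  by (simp add: is_spacetime_def lorentzian_metric_def lorentzian_form_def)

lemma future_timelike_scaleR:
  assumes "is_spacetime M" and "c \<in> atlas M" and "x \<in> fst c"
    and "s > 0" and "future_timelike M c x v"
  shows "future_timelike M c x (s *\<^sub>R v)"
  using spacetime_metric_bilinear[OF assms(1-3)] assms(4,5)
  by (simp add: future_timelike_def bilinear_lmul bilinear_rmul mult_pos_neg)

text \<open>Both inequalities are pairings by the metric, and the metric and the time field obey the
  same change of coordinates, so the pairings take equal values in the two charts.\<close>

lemma future_timelike_coord_change:
  assumes "is_spacetime M" and "c \<in> atlas M" and "d \<in> atlas M" and "x \<in> fst c" and "x \<in> fst d"
    and "future_timelike M c x v"
  shows "future_timelike M d x (coord_change c d x v)"
proof -
  have "metric M c x u w = metric M d x (coord_change c d x u) (coord_change c d x w)" for u w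
    using assms(1-5) unfolding is_spacetime_def lorentzian_metric_def by blast
  moreover have "time_field M d x = coord_change c d x (time_field M c x)"
    using assms(1-5) unfolding is_spacetime_def time_orienting_field_def by blast
  ultimately show ?thesis
    using assms(6) by (simp add: future_timelike_def)
qed

text \<open>Both inequalities are open conditions on the pair of a coordinate point and a vector. A
  product neighbourhood of one solution then gives a cone of directions valid at all nearby points
  at once.\<close>

lemma uniform_future_cone:
  fixes M :: "('a, 'e::euclidean_space) spacetime"
  assumes M: "is_spacetime M" and c: "c \<in> atlas M" and x: "x \<in> fst c"
  obtains r v where "r > 0" and "ball (snd c x) r \<subseteq> snd c ` fst c"
    and "\<And>y w. y \<in> ball (snd c x) r \<Longrightarrow> w \<in> ball v r \<Longrightarrow>
      future_timelike M c (inv_into (fst c) (snd c) y) w"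
proof -
  let ?h = "inv_into (fst c) (snd c)" and ?E = "snd c ` fst c"
  define v where "v = time_field M c x"
  have ch: "chart_on (events M) c"
    using M c spacetime_chart_on by blast
  then have E: "open ?E"
    by (simp add: chart_on_def)
  have hE: "?h y \<in> fst c" if "y \<in> ?E" for y
    using that by (simp add: inv_into_into)
  have bil: "bilinear (metric M c (?h (fst z)))" if "z \<in> ?E \<times> UNIV" for z :: "'e \<times> 'e"
    using that spacetime_metric_bilinear[OF M c] hE by auto
  have "continuous_on ?E (\<lambda>y. metric M c (?h y) u w)" for u w
  proof -
    have "Ck_on 0 ?E (\<lambda>y. metric M c (?h y) u w)"
      using M c unfolding is_spacetime_def lorentzian_metric_def smooth_on_def by blast
    then show ?thesis by simp
  qed
  then have cont_metric: "continuous_on (?E \<times> UNIV) (\<lambda>z. metric M c (?h (fst z)) u w)" for u w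
    by (rule continuous_on_compose2) (auto intro: continuous_intros)
  have "continuous_map (subtopology (events M) (fst c)) euclidean (time_field M c)"
    using M c by (simp add: is_spacetime_def time_orienting_field_def)
  then have "continuous_map (top_of_set ?E) euclidean (time_field M c \<circ> ?h)"
    using chart_on_homeomorphic_maps[OF ch] continuous_map_compose
    unfolding homeomorphic_maps_def by blast
  then have "continuous_on ?E (\<lambda>y. time_field M c (?h y))"
    by (simp add: o_def)
  then have cont_field: "continuous_on (?E \<times> UNIV) (\<lambda>z. time_field M c (?h (fst z)))"
    by (rule continuous_on_compose2) (auto intro: continuous_intros)
  have op: "open (?E \<times> (UNIV::'e set))"
    using E by (simp add: open_Times)
  let ?A = "{z \<in> ?E \<times> (UNIV::'e set). metric M c (?h (fst z)) (snd z) (snd z) < 0}"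
  let ?B = "{z \<in> ?E \<times> (UNIV::'e set).
    metric M c (?h (fst z)) (time_field M c (?h (fst z))) (snd z) < 0}"
  have "open ?A"
    using continuous_on_bilinear_form[where B = "\<lambda>z. metric M c (?h (fst z))" and f = snd and g = snd,
        OF bil cont_metric continuous_on_snd continuous_on_snd, OF _ continuous_on_id continuous_on_id]
    by (intro open_negative_set[OF op]) simp
  moreover have "open ?B"
    using continuous_on_bilinear_form[where B = "\<lambda>z. metric M c (?h (fst z))" and g = snd,
        OF bil cont_metric cont_field continuous_on_snd, OF _ continuous_on_id]
    by (intro open_negative_set[OF op]) simp
  ultimately have "open (?A \<inter> ?B)"
    by blast
  \<comment> \<open>At \<open>snd c x\<close> with \<open>v\<close> the time field itself, both
    inequalities reduce to the timelikeness of that field.\<close>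
  moreover have "metric M c x v v < 0"
    using M c x unfolding v_def is_spacetime_def time_orienting_field_def by blast
  then have "(snd c x, v) \<in> ?A \<inter> ?B"
    using x chart_on_inverse[OF ch x] by (simp add: v_def)
  ultimately obtain P Q where "open P" "open Q" "(snd c x, v) \<in> P \<times> Q"
    and PQsub: "P \<times> Q \<subseteq> ?A \<inter> ?B"
    by (rule open_prod_elim)
  then have PQ: "open P" "open Q" "snd c x \<in> P" "v \<in> Q"
    by auto
  obtain r1 where r1: "r1 > 0" "ball (snd c x) r1 \<subseteq> P"
    using PQ openE by blast
  obtain r2 where r2: "r2 > 0" "ball v r2 \<subseteq> Q"
    using PQ openE by blast
  show thesis
  proof
    show "min r1 r2 > 0"
      using r1 r2 by simp
    show "ball (snd c x) (min r1 r2) \<subseteq> ?E"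
    proof
      fix y assume "y \<in> ball (snd c x) (min r1 r2)"
      then have "(y, v) \<in> P \<times> Q"
        using r1 PQ by auto
      then show "y \<in> ?E"
        using PQsub by blast
    qed
    fix y w assume "y \<in> ball (snd c x) (min r1 r2)" "w \<in> ball v (min r1 r2)"
    then have "(y, w) \<in> P \<times> Q"
      using r1 r2 by auto
    then have "(y, w) \<in> ?A \<inter> ?B"
      using PQsub by blast
    then show "future_timelike M c (?h y) w"
      by (simp add: future_timelike_def)
  qed
qed

section \<open>Timelike lines in coordinates\<close>

lemma timelike_curve_segment:
  assumes "timelike_segment M \<gamma> a b" and "a < b"
    and "continuous_map (top_of_set {a..b}) (events M) \<gamma>"
  shows "(\<gamma> a, \<gamma> b) \<in> I_plus M"
proof -
  \<comment> \<open>A single segment is a partition with one piece: \<open>n = 1\<close>,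
    \<open>s 0 = a\<close> and \<open>s 1 = b\<close>.\<close>
  have "timelike_curve M \<gamma> a b"
    unfolding timelike_curve_def using assms
    by (intro conjI exI[of _ 1] exI[of _ "\<lambda>i::nat. if i = 0 then a else b"]) auto
  then show ?thesis
    by (auto simp: I_plus_def)
qed

text \<open>In the chart \<open>c\<close> the line has the constant velocity \<open>z - y\<close>.
  In any other chart \<open>d\<close> its velocity is the image of \<open>z - y\<close> under the
  derivative of the transition map, which varies continuously and stays future timelike.\<close>

lemma coordinate_line_I_plus:
  fixes M :: "('a, 'e::euclidean_space) spacetime"
  assumes M: "is_spacetime M" and c: "c \<in> atlas M"
    and seg: "closed_segment y z \<subseteq> snd c ` fst c"
    and fut: "\<And>q. q \<in> closed_segment y z \<Longrightarrow>
      future_timelike M c (inv_into (fst c) (snd c) q) (z - y)"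
  shows "(inv_into (fst c) (snd c) y, inv_into (fst c) (snd c) z) \<in> I_plus M"
proof -
  let ?h = "inv_into (fst c) (snd c)"
  define l where "l = (\<lambda>t::real. y + t *\<^sub>R (z - y))"
  have ch: "chart_on (events M) c"
    using M c spacetime_chart_on by blast
  have l: "l t \<in> closed_segment y z" if "t \<in> {0..1}" for t
    using that by (auto simp: l_def in_segment algebra_simps intro!: exI[of _ t])
  have lder: "(l has_vector_derivative (z - y)) (at t within S)" for t S
    unfolding l_def by (auto intro!: derivative_eq_intros)
  have lcont: "continuous_on S l" for S
    unfolding l_def by (intro continuous_intros)
  have hc: "?h (l t) \<in> fst c" and sh: "snd c (?h (l t)) = l t" if "t \<in> {0..1}" for t
    using l[OF that] seg by (auto simp: inv_into_into f_inv_into_f subset_iff)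
  have "continuous_map (top_of_set {0..1}) (top_of_set (snd c ` fst c)) l"
    using lcont l seg by (auto simp: continuous_map_in_subtopology)
  then have cont: "continuous_map (top_of_set {0..1}) (events M) (?h \<circ> l)"
    using continuous_map_compose chart_on_continuous_inverse[OF ch] by blast
  have "timelike_segment M (?h \<circ> l) 0 1"
    unfolding timelike_segment_def
  proof
    fix d assume d: "d \<in> atlas M"
    let ?S = "{t \<in> {0..1}. (?h \<circ> l) t \<in> fst d}" and ?T = "snd c ` (fst c \<inter> fst d)"
    let ?g = "\<lambda>t. frechet_derivative (transition c d) (at (l t)) (z - y)"
    have "smooth_on ?T (transition c d)"
      using M c d by (simp add: is_spacetime_def smooth_manifold_def smooth_atlas_def)
    \<comment> \<open>Order one of smoothness supplies both differentiability of the transition map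
      and continuity of its derivative in the direction \<open>z - y\<close>.\<close>
    then have "Ck_on (Suc 0) ?T (transition c d)"
      unfolding smooth_on_def by blast
    then have diff: "\<And>q. q \<in> ?T \<Longrightarrow> transition c d differentiable (at q)"
      and contd: "continuous_on ?T (\<lambda>q. frechet_derivative (transition c d) (at q) (z - y))"
      by auto
    have lT: "l t \<in> ?T" if "t \<in> ?S" for t
      using that hc[of t] sh[of t] by (metis (mono_tags, lifting) IntI comp_apply image_eqI mem_Collect_eq)
    have "continuous_on ?S ?g"
      using lT by (intro continuous_on_compose2[OF contd lcont]) auto
    moreover have "(snd d \<circ> (?h \<circ> l) has_vector_derivative ?g t) (at t within {0..1}) \<and>
        future_timelike M d ((?h \<circ> l) t) (?g t)"
      if t: "t \<in> {0..1}" "(?h \<circ> l) t \<in> fst d" for t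
    proof
      have "(transition c d has_derivative frechet_derivative (transition c d) (at (l t))) (at (l t))"
        using diff lT t frechet_derivative_works by blast
      then have "(transition c d has_derivative frechet_derivative (transition c d) (at (l t)))
          (at (l t) within l ` {0..1})"
        by (rule has_derivative_at_withinI)
      then have "((transition c d \<circ> l) has_vector_derivative ?g t) (at t within {0..1})"
        using lder by (metis vector_derivative_diff_chain_within)
      moreover have "transition c d \<circ> l = snd d \<circ> (?h \<circ> l)"
        by (simp add: transition_def o_assoc)
      ultimately show "(snd d \<circ> (?h \<circ> l) has_vector_derivative ?g t) (at t within {0..1})"
        by simp
      have "future_timelike M d (?h (l t)) (coord_change c d (?h (l t)) (z - y))"
        using t hc[of t] fut[OF l[of t]] by (intro future_timelike_coord_change[OF M c d]) auto
      then show "future_timelike M d ((?h \<circ> l) t) (?g t)"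
        using sh[OF t(1)] by (simp add: coord_change_def)
    qed
    ultimately show "\<exists>\<gamma>'. continuous_on ?S \<gamma>' \<and>
        (\<forall>t\<in>{0..1}. (?h \<circ> l) t \<in> fst d \<longrightarrow>
           (snd d \<circ> (?h \<circ> l) has_vector_derivative \<gamma>' t) (at t within {0..1}) \<and>
           future_timelike M d ((?h \<circ> l) t) (\<gamma>' t))"
      by blast
  qed
  then have "((?h \<circ> l) 0, (?h \<circ> l) 1) \<in> I_plus M"
    using timelike_curve_segment[OF _ zero_less_one cont] by blast
  then show ?thesis
    by (simp add: l_def)
qed

text \<open>Step back from \<open>x\<close> against a direction \<open>v\<close> inside the uniform
  cone. Slightly moving the endpoint only tilts the direction, so each \<open>y i\<close> also
  precedes a whole neighbourhood \<open>V i\<close> of \<open>x\<close>.\<close>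

lemma chronological_sequence_to_point:
  fixes M :: "('a, 'e::euclidean_space) spacetime"
  assumes M: "is_spacetime M" and x: "x \<in> topspace (events M)"
  obtains y :: "nat \<Rightarrow> 'a" and V where
    "\<And>i. y i \<in> topspace (events M)"
    and "\<And>i. (y i, y (Suc i)) \<in> I_plus M"
    and "limitin (events M) y x sequentially"
    and "\<And>i. openin (events M) (V i)" and "\<And>i. x \<in> V i"
    and "\<And>i q. q \<in> V i \<Longrightarrow> (y i, q) \<in> I_plus M"
proof -
  obtain c where c: "c \<in> atlas M" "x \<in> fst c" and ch: "chart_on (events M) c"
    using spacetime_chart_around[OF M x] by metis
  let ?h = "inv_into (fst c) (snd c)"
  obtain r v where r: "r > 0" and ball: "ball (snd c x) r \<subseteq> snd c ` fst c"
    and cone: "\<And>q w. q \<in> ball (snd c x) r \<Longrightarrow> w \<in> ball v r \<Longrightarrow> future_timelike M c (?h q) w"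
    using uniform_future_cone[OF M c] by metis
  \<comment> \<open>The ball is convex and the cone is valid throughout it, so a displacement by a
    positive multiple of a cone vector is a timelike line.\<close>
  have line: "(?h a, ?h b) \<in> I_plus M"
    if a: "a \<in> ball (snd c x) r" and b: "b \<in> ball (snd c x) r"
      and s: "s > 0" and w: "w \<in> ball v r" and ab: "b - a = s *\<^sub>R w" for a b s w
  proof -
    have sub: "closed_segment a b \<subseteq> ball (snd c x) r"
      using a b by (simp add: closed_segment_subset)
    show ?thesis
    proof (rule coordinate_line_I_plus[OF M c(1)])
      show "closed_segment a b \<subseteq> snd c ` fst c"
        using sub ball by blast
      fix q assume "q \<in> closed_segment a b"
      then have q: "q \<in> ball (snd c x) r"
        using sub by blast
      then have "?h q \<in> fst c"
        using ball by (meson inv_into_into subsetD)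
      then show "future_timelike M c (?h q) (b - a)"
        using future_timelike_scaleR[OF M c(1) _ s cone[OF q w]] ab by simp
    qed
  qed
  \<comment> \<open>The factor \<open>r / (norm v + 1)\<close> makes
    \<open>s i * norm v < r\<close>, so every \<open>a i\<close> stays in the ball; the other factor
    makes \<open>s\<close> decrease strictly to 0.\<close>
  define s where "s = (\<lambda>i::nat. r / (norm v + 1) / (real i + 1))"
  define a where "a = (\<lambda>i. snd c x - s i *\<^sub>R v)"
  \<comment> \<open>The radius \<open>s i * r\<close> is such that a displacement from
    \<open>a i\<close> into this ball, divided by \<open>s i\<close>, differs from \<open>v\<close>
    by less than \<open>r\<close>; the bound \<open>r\<close> keeps the endpoint in the
    ball.\<close>
  define V where "V = (\<lambda>i. ?h ` ball (snd c x) (min r (s i * r)))"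
  have s0: "s i > 0" for i
    using r norm_ge_zero[of v] by (simp add: s_def add_nonneg_pos)
  have sSuc: "s (Suc i) < s i" for i
  proof -
    have "r / (norm v + 1) > 0"
      using r norm_ge_zero[of v] by (simp add: add_nonneg_pos)
    then show ?thesis
      unfolding s_def by (intro divide_strict_left_mono) auto
  qed
  have slim: "s \<longlonglongrightarrow> 0"
    unfolding s_def using LIMSEQ_Suc[OF lim_const_over_n, of "r / (norm v + 1)"]
    by (simp add: add.commute)
  have aball: "a i \<in> ball (snd c x) r" for i
  proof -
    have "s i \<le> r / (norm v + 1)"
      using divide_left_mono[of 1 "real i + 1" "r / (norm v + 1)"] r by (simp add: s_def)
    then have "s i * norm v \<le> r / (norm v + 1) * norm v"
      by (rule mult_right_mono) simp
    also have "\<dots> < r"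
      using r norm_ge_zero[of v] by (simp add: divide_less_eq add_nonneg_pos)
    finally show ?thesis
      using s0[of i] by (simp add: a_def dist_norm)
  qed
  have alim: "a \<longlonglongrightarrow> snd c x"
    unfolding a_def using slim by (auto intro!: tendsto_eq_intros)
  show thesis
  proof
    show "?h (a i) \<in> topspace (events M)" for i
    proof -
      have "?h (a i) \<in> fst c"
        using aball[of i] ball by (meson inv_into_into subsetD)
      then show ?thesis
        using ch openin_subset by (auto simp: chart_on_def)
    qed
    show "(?h (a i), ?h (a (Suc i))) \<in> I_plus M" for i
    proof (rule line[OF aball aball])
      show "s i - s (Suc i) > 0"
        using sSuc[of i] by simp
      show "a (Suc i) - a i = (s i - s (Suc i)) *\<^sub>R v"
        by (simp add: a_def algebra_simps)
    qed (use r in simp)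
    have "limitin (top_of_set (snd c ` fst c)) a (snd c x) sequentially"
      using alim c(2) ch by (simp add: chart_on_def)
    then have "limitin (events M) (?h \<circ> a) (?h (snd c x)) sequentially"
      by (rule continuous_map_limit[OF chart_on_continuous_inverse[OF ch]])
    then show "limitin (events M) (\<lambda>i. ?h (a i)) x sequentially"
      using chart_on_inverse[OF ch c(2)] by (simp add: o_def)
    show "openin (events M) (V i)" for i
      unfolding V_def using ball by (intro chart_on_open_image_inverse[OF ch]) auto
    show "x \<in> V i" for i
      unfolding V_def using r s0[of i] chart_on_inverse[OF ch c(2)]
      by (intro image_eqI[of _ _ "snd c x"]) auto
    show "(?h (a i), q) \<in> I_plus M" if q: "q \<in> V i" for i q
    proof -
      obtain b where b: "q = ?h b" "b \<in> ball (snd c x) r" "norm (b - snd c x) < s i * r"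
        using q unfolding V_def by (auto simp: dist_norm norm_minus_commute)
      define w where "w = v + (1 / s i) *\<^sub>R (b - snd c x)"
      have "w \<in> ball v r"
        using b(3) s0[of i] by (simp add: w_def dist_norm divide_less_eq mult.commute)
      moreover have "b - a i = s i *\<^sub>R w"
        using s0[of i] by (simp add: w_def a_def algebra_simps)
      ultimately show ?thesis
        using line[OF aball b(2) s0[of i]] b(1) by blast
    qed
  qed
qed


section \<open>The relation \<open>K_plus\<close>\<close>

lemma I_plus_subset_topspace:
  "I_plus M \<subseteq> topspace (events M) \<times> topspace (events M)"
proof clarify
  fix p q assume "(p, q) \<in> I_plus M"
  then obtain \<gamma> a b where "a < b" "continuous_map (top_of_set {a..b::real}) (events M) \<gamma>"
    "\<gamma> a = p" "\<gamma> b = q"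
    by (auto simp: I_plus_def timelike_curve_def)
  then show "p \<in> topspace (events M) \<and> q \<in> topspace (events M)"
    using continuous_map_image_subset_topspace[of "top_of_set {a..b}" "events M" \<gamma>] by auto
qed

lemma I_plus_subset_K_plus: "I_plus M \<subseteq> K_plus M"
  by (auto simp: K_plus_def)

lemma trans_K_plus: "trans (K_plus M)"
  unfolding K_plus_def trans_def by blast

lemma closedin_K_plus: "closedin (prod_topology (events M) (events M)) (K_plus M)"
  unfolding K_plus_def
proof (rule closedin_Inter)
  \<comment> \<open>The total relation on the events belongs to the family being intersected, so the
    intersection is not over the empty family, where it would be \<open>UNIV\<close>.\<close>
  have "trans (topspace (events M) \<times> topspace (events M))"
    by (auto simp: trans_def)
  then show "{R. I_plus M \<subseteq> R \<and> trans R \<and> closedin (prod_topology (events M) (events M)) R} \<noteq> {}"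
    using I_plus_subset_topspace closedin_topspace[of "prod_topology (events M) (events M)"]
    by (intro ex_in_conv[THEN iffD1] exI[of _ "topspace (events M) \<times> topspace (events M)"]) simp
qed auto

lemma K_plus_subset_topspace:
  "K_plus M \<subseteq> topspace (events M) \<times> topspace (events M)"
  using closedin_subset[OF closedin_K_plus] by simp

lemma K_plus_minimal:
  assumes "I_plus M \<subseteq> R" and "trans R" and "closedin (prod_topology (events M) (events M)) R"
  shows "K_plus M \<subseteq> R"
  using assms by (auto simp: K_plus_def)

text \<open>The form in which closedness of \<open>K_plus\<close> is applied: a constant map in one
  place gives closed sets of points above or below a given event.\<close>

lemma closedin_K_plus_preimage:
  assumes "continuous_map Z (events M) f" and "continuous_map Z (events M) g"
  shows "closedin Z {z \<in> topspace Z. (f z, g z) \<in> K_plus M}"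
  using closedin_continuous_map_preimage[OF continuous_map_pairedI[OF assms] closedin_K_plus] .

lemma closedin_K_future:
  assumes "p \<in> topspace (events M)"
  shows "closedin (events M) (K_future M p)"
proof -
  have "closedin (events M) {q \<in> topspace (events M). (p, q) \<in> K_plus M}"
    using assms by (intro closedin_K_plus_preimage) (auto intro: continuous_intros)
  moreover have "{q \<in> topspace (events M). (p, q) \<in> K_plus M} = K_future M p"
    using K_plus_subset_topspace by (auto simp: K_future_def)
  ultimately show ?thesis
    by simp
qed

text \<open>A subarc within one differentiable piece is itself timelike, and transitivity joins such
  arcs at the break points. Reflexivity covers \<open>u = w\<close>, since timelike curves have
  parameter intervals of positive length.\<close>

lemma timelike_curve_K_plus:
  assumes refl: "refl_on (topspace (events M)) (K_plus M)"
    and curve: "timelike_curve M \<gamma> a b" and uw: "a \<le> u" "u \<le> w" "w \<le> b"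
  shows "(\<gamma> u, \<gamma> w) \<in> K_plus M"
proof -
  have cont: "continuous_map (top_of_set {a..b}) (events M) \<gamma>"
    using curve by (simp add: timelike_curve_def)
  obtain n s where s: "s 0 = a" "s n = b"
    and seg: "\<And>i. i < (n::nat) \<Longrightarrow> s i < s (Suc i) \<and> timelike_segment M \<gamma> (s i) (s (Suc i))"
    using curve unfolding timelike_curve_def by blast
  have sa: "a \<le> s i" if "i \<le> n" for i
    using that
  proof (induction i)
    case (Suc i)
    then show ?case using seg[of i] by simp
  qed (simp add: s)
  have sb: "s i \<le> b" if "i \<le> n" for i
    using that
  proof (induction i rule: inc_induct)
    case (step i)
    then show ?case using seg[of i] by simp
  qed (simp add: s)
  have rf: "(\<gamma> t, \<gamma> t) \<in> K_plus M" if "a \<le> t" "t \<le> b" for t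
    using continuous_map_image_subset_topspace[OF cont] refl that
    by (simp add: refl_on_def image_subset_iff)
  have piece: "(\<gamma> t, \<gamma> t') \<in> K_plus M"
    if i: "i < n" and t: "s i \<le> t" "t \<le> t'" "t' \<le> s (Suc i)" for i t t'
  proof (cases "t = t'")
    case True
    then show ?thesis
      using rf[of t] sa[of i] sb[of "Suc i"] i t by simp
  next
    case False
    have "timelike_segment M \<gamma> t t'"
      unfolding timelike_segment_def
    proof
      fix c assume "c \<in> atlas M"
      then obtain \<gamma>' where g:
        "continuous_on {t\<in>{s i..s (Suc i)}. \<gamma> t \<in> fst c} \<gamma>'"
        "\<And>t. t\<in>{s i..s (Suc i)} \<Longrightarrow> \<gamma> t \<in> fst c \<Longrightarrow>
           (snd c \<circ> \<gamma> has_vector_derivative \<gamma>' t) (at t within {s i..s (Suc i)}) \<and>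
           future_timelike M c (\<gamma> t) (\<gamma>' t)"
        using seg[OF i] unfolding timelike_segment_def by meson
      have sub: "{t..t'} \<subseteq> {s i..s (Suc i)}"
        using t by auto
      show "\<exists>\<gamma>'. continuous_on {u\<in>{t..t'}. \<gamma> u \<in> fst c} \<gamma>' \<and>
        (\<forall>u\<in>{t..t'}. \<gamma> u \<in> fst c \<longrightarrow>
           (snd c \<circ> \<gamma> has_vector_derivative \<gamma>' u) (at u within {t..t'}) \<and>
           future_timelike M c (\<gamma> u) (\<gamma>' u))"
      \<comment> \<open>The velocity on the whole piece also serves on the subinterval, as
        derivatives within an interval restrict.\<close>
      proof (intro exI[of _ \<gamma>'] conjI ballI impI)
        show "continuous_on {u\<in>{t..t'}. \<gamma> u \<in> fst c} \<gamma>'"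
          using sub by (intro continuous_on_subset[OF g(1)]) auto
        fix u assume u: "u \<in> {t..t'}" "\<gamma> u \<in> fst c"
        then show "(snd c \<circ> \<gamma> has_vector_derivative \<gamma>' u) (at u within {t..t'})"
          using g(2)[of u] sub has_vector_derivative_within_subset by blast
        show "future_timelike M c (\<gamma> u) (\<gamma>' u)"
          using g(2)[of u] sub u by blast
      qed
    qed
    moreover have "{t..t'} \<subseteq> {a..b}"
      using sa[of i] sb[of "Suc i"] i t by simp
    then have "continuous_map (top_of_set {t..t'}) (events M) \<gamma>"
      using cont continuous_map_from_subtopology_mono by blast
    ultimately show ?thesis
      using timelike_curve_segment[of M \<gamma> t t'] I_plus_subset_K_plus t False by fastforce
  qed
  \<comment> \<open>Induction on the number of pieces. For \<open>i = 0\<close> the bounds force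
    \<open>u = w = a\<close>; in the step, a pair on both sides of \<open>s i\<close> is joined
    through \<open>\<gamma> (s i)\<close>.\<close>
  have "(\<gamma> u, \<gamma> w) \<in> K_plus M" if "i \<le> n" "a \<le> u" "u \<le> w" "w \<le> s i" for i u w
    using that
  proof (induction i arbitrary: u w)
    case 0
    then show ?case
      using rf[of u] s(1) sb[of 0] by (auto dest!: order_antisym[of u w])
  next
    case (Suc i)
    have i: "i < n" and "a \<le> s i"
      using Suc.prems sa by auto
    consider "w \<le> s i" | "s i \<le> u" | "u \<le> s i" "s i \<le> w"
      by linarith
    then show ?case
    proof cases
      case 1
      then show ?thesis using Suc by simp
    next
      case 2
      then show ?thesis using piece[OF i] Suc.prems by simp
    next
      case 3
      then have "(\<gamma> u, \<gamma> (s i)) \<in> K_plus M" "(\<gamma> (s i), \<gamma> w) \<in> K_plus M"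
        using Suc piece[OF i, of "s i" w] by auto
      then show ?thesis
        using trans_K_plus transD by metis
    qed
  qed
  then show ?thesis
    using uw s(2) by blast
qed

section \<open>\<open>K_plus\<close> and compact frontiers\<close>

lemma closedin_K_plus_between:
  assumes "compactin (events M) F"
  shows "closedin (prod_topology (events M) (events M))
    {(a, b). \<exists>z\<in>F. (a, z) \<in> K_plus M \<and> (z, b) \<in> K_plus M}" (is "closedin ?XX ?P")
proof -
  let ?X = "events M" and ?Y = "subtopology (events M) F"
  let ?Z = "prod_topology ?XX ?Y"
  have c1: "continuous_map ?Z ?X (\<lambda>u. fst (fst u))" and c2: "continuous_map ?Z ?X (\<lambda>u. snd (fst u))"
    using continuous_map_compose[OF continuous_map_fst[of ?XX ?Y] continuous_map_fst]
      continuous_map_compose[OF continuous_map_fst[of ?XX ?Y] continuous_map_snd]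
    by (simp_all add: o_def)
  have c3: "continuous_map ?Z ?X snd"
    using continuous_map_snd[of ?XX ?Y] by (simp add: continuous_map_in_subtopology)
  \<comment> \<open>Keeping the intermediate point as a third coordinate makes the condition closed.
    Forgetting it is a projection along the compact factor \<open>F\<close>, hence a closed
    map.\<close>
  let ?S = "{u \<in> topspace ?Z. (fst (fst u), snd u) \<in> K_plus M} \<inter>
    {u \<in> topspace ?Z. (snd u, snd (fst u)) \<in> K_plus M}"
  have "closedin ?Z ?S"
    using c1 c2 c3 by (intro closedin_Int closedin_K_plus_preimage)
  moreover have "closed_map ?Z ?XX fst"
    using assms compact_space_subtopology Abstract_Topological_Spaces.closed_map_fst by blast
  ultimately have "closedin ?XX (fst ` ?S)"
    by (simp add: closed_map_def)
  moreover have "fst ` ?S = ?P"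
  proof
    show "fst ` ?S \<subseteq> ?P"
      by (auto simp: case_prod_unfold)
    show "?P \<subseteq> fst ` ?S"
    proof clarify
      fix a b z assume z: "z \<in> F" "(a, z) \<in> K_plus M" "(z, b) \<in> K_plus M"
      then have "((a, b), z) \<in> ?S"
        using K_plus_subset_topspace[of M] by auto
      then show "(a, b) \<in> fst ` ?S"
        by (metis (no_types, lifting) fst_conv image_eqI)
    qed
  qed
  ultimately show ?thesis
    by simp
qed

text \<open>The pairs of \<open>K_plus\<close> satisfying the conclusion form a closed transitive relation
  containing \<open>I_plus\<close>, hence are all of \<open>K_plus\<close>. Reflexivity gives closedness at pairs whose first
  component lies on the frontier.\<close>

lemma K_plus_crosses_frontier:
  assumes refl: "refl_on (topspace (events M)) (K_plus M)"
    and W: "openin (events M) W" and comp: "compactin (events M) (events M frontier_of W)"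
    and ab: "(a, b) \<in> K_plus M" "a \<notin> W" "b \<in> W"
  shows "\<exists>z \<in> events M frontier_of W. (a, z) \<in> K_plus M \<and> (z, b) \<in> K_plus M"
proof -
  let ?X = "events M" and ?F = "events M frontier_of W"
  let ?XX = "prod_topology ?X ?X"
  define P where "P = {(a, b). \<exists>z\<in>?F. (a, z) \<in> K_plus M \<and> (z, b) \<in> K_plus M}"
  define R where "R = {(a, b) \<in> K_plus M. a \<notin> W \<longrightarrow> b \<in> W \<longrightarrow> (a, b) \<in> P}"
  have trK: "(u, w) \<in> K_plus M" if "(u, v) \<in> K_plus M" "(v, w) \<in> K_plus M" for u v w
    using trans_K_plus that by (rule transD)
  \<comment> \<open>The implication in \<open>R\<close> is a union of three cases. The case
    \<open>a \<in> W\<close> is not closed, so \<open>W\<close> is replaced by its closure; the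
    added pairs lie in \<open>P\<close>, with \<open>a\<close> itself as the frontier point.\<close>
  have "closedin ?XX (K_plus M \<inter> ((topspace ?X \<times> (topspace ?X - W)) \<union>
      ((?X closure_of W) \<times> topspace ?X) \<union> P))"
    using W closedin_K_plus_between[OF comp]
    by (intro closedin_Int closedin_Un closedin_K_plus)
      (auto simp: closedin_prod_Times_iff P_def)
  moreover have "R = K_plus M \<inter> ((topspace ?X \<times> (topspace ?X - W)) \<union>
      ((?X closure_of W) \<times> topspace ?X) \<union> P)" (is "R = ?R")
  proof (intro equalityI subsetI)
    fix u assume u: "u \<in> R"
    then show "u \<in> ?R"
      using K_plus_subset_topspace[of M] closure_of_subset[of W ?X] openin_subset[OF W]
      by (auto simp: R_def)
  next
    fix u assume u: "u \<in> ?R"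
    obtain v w where vw: "u = (v, w)"
      by fastforce
    have "(v, w) \<in> P" if "v \<in> ?X closure_of W" "v \<notin> W"
    proof -
      have "v \<in> ?F"
        using that W by (simp add: frontier_of_def interior_of_openin)
      moreover have "(v, v) \<in> K_plus M"
        using that refl in_closure_of[of v ?X W] by (simp add: refl_on_def)
      ultimately show ?thesis
        using u vw by (auto simp: P_def)
    qed
    then show "u \<in> R"
      using u vw by (auto simp: R_def)
  qed
  ultimately have closedR: "closedin ?XX R"
    by simp
  have transR: "trans R"
  proof (rule transI)
    fix u v w assume uv: "(u, v) \<in> R" "(v, w) \<in> R"
    then have K: "(u, v) \<in> K_plus M" "(v, w) \<in> K_plus M"
      by (auto simp: R_def)
    \<comment> \<open>The middle point decides which of the two pairs enters \<open>W\<close>; the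
      frontier point of that pair serves for the composite.\<close>
    have "(u, w) \<in> P" if u: "u \<notin> W" and w: "w \<in> W"
    proof (cases "v \<in> W")
      case True
      then obtain z where "z \<in> ?F" "(u, z) \<in> K_plus M" "(z, v) \<in> K_plus M"
        using uv(1) u by (auto simp: R_def P_def)
      then show ?thesis
        using trK[OF _ K(2)] by (auto simp: P_def)
    next
      case False
      then obtain z where "z \<in> ?F" "(v, z) \<in> K_plus M" "(z, w) \<in> K_plus M"
        using uv(2) w by (auto simp: R_def P_def)
      then show ?thesis
        using trK[OF K(1)] by (auto simp: P_def)
    qed
    then show "(u, w) \<in> R"
      using K trK by (auto simp: R_def)
  qed
  have "I_plus M \<subseteq> R"
  proof clarify
    fix u v assume uv: "(u, v) \<in> I_plus M"
    then obtain \<gamma> s t where g: "timelike_curve M \<gamma> s t" "\<gamma> s = u" "\<gamma> t = v"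
      by (auto simp: I_plus_def)
    then have st: "s < t" and cont: "continuous_map (top_of_set {s..t}) ?X \<gamma>"
      by (auto simp: timelike_curve_def)
    have "(u, v) \<in> P" if "u \<notin> W" "v \<in> W"
    proof -
      \<comment> \<open>The connected image of the curve meets both \<open>W\<close> and its
        complement, so it meets the frontier.\<close>
      have "connectedin (top_of_set {s..t}) {s..t}"
        by (simp add: connectedin_subtopology)
      then have "connectedin ?X (\<gamma> ` {s..t})"
        using cont connectedin_continuous_map_image by blast
      moreover have "u \<in> \<gamma> ` {s..t}" "v \<in> \<gamma> ` {s..t}"
        using g st by (auto intro!: image_eqI)
      ultimately have "\<gamma> ` {s..t} \<inter> ?F \<noteq> {}"
        using that by (intro connectedin_Int_frontier_of) auto
      then obtain r where r: "r \<in> {s..t}" "\<gamma> r \<in> ?F"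
        by blast
      then have "(u, \<gamma> r) \<in> K_plus M" "(\<gamma> r, v) \<in> K_plus M"
        using timelike_curve_K_plus[OF refl g(1), of s r]
          timelike_curve_K_plus[OF refl g(1), of r t] g by auto
      then show ?thesis
        using r by (auto simp: P_def)
    qed
    then show "(u, v) \<in> R"
      using uv I_plus_subset_K_plus by (auto simp: R_def)
  qed
  then have "(a, b) \<in> R"
    using K_plus_minimal closedR transR ab(1) by blast
  then show ?thesis
    using ab by (auto simp: R_def P_def)
qed

text \<open>If the sequence avoids a neighbourhood \<open>W\<close> of the supremum \<open>x\<close>, then by compactness some point
  of the frontier of \<open>W\<close> is an upper bound below \<open>x\<close>, hence equal to \<open>x\<close> by antisymmetry.\<close>

lemma K_sup_in_closure:
  fixes M :: "('a, 'e::euclidean_space) spacetime" and y :: "nat \<Rightarrow> 'a"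
  assumes M: "is_spacetime M" and K: "K_causal M"
    and mono: "\<And>i. (y i, y (Suc i)) \<in> K_plus M"
    and sup: "is_sup_in (topspace (events M)) (K_plus M) (range y) x"
  shows "x \<in> events M closure_of (range y)"
proof (rule ccontr)
  let ?X = "events M"
  assume "x \<notin> ?X closure_of (range y)"
  have xX: "x \<in> topspace ?X" and ub: "\<And>i. (y i, x) \<in> K_plus M"
    and lub: "\<And>z. z \<in> topspace ?X \<Longrightarrow> (\<And>i. (y i, z) \<in> K_plus M) \<Longrightarrow> (x, z) \<in> K_plus M"
    using sup by (auto simp: is_sup_in_def)
  have refl: "refl_on (topspace ?X) (K_plus M)" and anti: "antisym (K_plus M)"
    using K by (auto simp: K_causal_def partial_order_on_def preorder_on_def)
  obtain U where U: "openin ?X U" "x \<in> U" "range y \<inter> U = {}"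
    using \<open>x \<notin> ?X closure_of (range y)\<close> xX by (auto simp: in_closure_of)
  obtain W where W: "openin ?X W" "x \<in> W" "W \<subseteq> U" and comp: "compactin ?X (?X frontier_of W)"
    using spacetime_open_nbhd_compact_frontier[OF M U(1,2)] by metis
  let ?F = "?X frontier_of W"
  \<comment> \<open>The frontier points between \<open>y i\<close> and \<open>x\<close>. These sets
    are closed in a compact space, nonempty by the crossing property and decreasing because
    \<open>y\<close> increases, so they have a common point.\<close>
  define C where "C = (\<lambda>i. {z \<in> topspace (subtopology ?X ?F). (y i, z) \<in> K_plus M} \<inter>
    {z \<in> topspace (subtopology ?X ?F). (z, x) \<in> K_plus M})"
  have yX: "y i \<in> topspace ?X" for i
    using mono[of i] K_plus_subset_topspace by blast
  have "(\<Inter>i. C i) \<noteq> {}"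
  proof (rule compact_space_imp_nest)
    show "compact_space (subtopology ?X ?F)"
      using comp by (rule compact_space_subtopology)
    show "closedin (subtopology ?X ?F) (C i)" for i
      unfolding C_def using yX xX
      by (intro closedin_Int closedin_K_plus_preimage)
        (auto intro: continuous_map_from_subtopology[OF continuous_map_id[unfolded id_def]])
    show "C i \<noteq> {}" for i
    proof -
      have "y i \<notin> W"
        using U W by blast
      then obtain z where z: "z \<in> ?F" "(y i, z) \<in> K_plus M" "(z, x) \<in> K_plus M"
        using K_plus_crosses_frontier[OF refl W(1) comp ub] W by blast
      then have "z \<in> topspace ?X"
        using K_plus_subset_topspace by blast
      then show ?thesis
        using z by (auto simp: C_def)
    qed
    show "decseq C"
      unfolding C_def using mono trans_K_plus[of M]
      by (intro decseq_SucI) (auto dest: transD)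
  qed
  then obtain z where z: "\<And>i. z \<in> C i"
    by blast
  then have "(x, z) \<in> K_plus M" "(z, x) \<in> K_plus M" "z \<in> ?F"
    using lub by (auto simp: C_def)
  then have "x \<in> ?F"
    using anti antisymD by metis
  \<comment> \<open>The open set \<open>W\<close> is disjoint from its frontier but contains
    \<open>x\<close>.\<close>
  then show False
    using W by (simp add: frontier_of_def interior_of_openin)
qed

section \<open>Equality of the topological and the order-theoretic boundary\<close>

theorem theorem3p3:
  fixes M :: "('a, 'e::euclidean_space) spacetime" and p :: 'a
  assumes "is_spacetime M"
    and "K_causal M"
    and "p \<in> topspace (events M)"
  shows "events M frontier_of K_future M p = causal_boundary M p"
proof (intro equalityI subsetI)
  let ?X = "events M"
  fix x assume x: "x \<in> ?X frontier_of K_future M p"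
  then have xK: "x \<in> K_future M p"
    using closedin_K_future[OF assms(3)] frontier_of_subset_closedin by blast
  have xX: "x \<in> topspace ?X"
    using x by (meson frontier_of_subset_topspace subsetD)
  obtain y :: "nat \<Rightarrow> 'a" and V where y: "\<And>i. y i \<in> topspace ?X"
    "\<And>i. (y i, y (Suc i)) \<in> I_plus M" "limitin ?X y x sequentially"
    and V: "\<And>i. openin ?X (V i)" "\<And>i. x \<in> V i" "\<And>i q. q \<in> V i \<Longrightarrow> (y i, q) \<in> I_plus M"
    using chronological_sequence_to_point[OF assms(1) xX] by blast
  \<comment> \<open>Otherwise transitivity puts the neighbourhood \<open>V i\<close> of
    \<open>x\<close> inside \<open>K_future M p\<close>, and \<open>x\<close> is an interior
    point.\<close>
  have "y i \<notin> K_future M p" for i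
  proof
    assume "y i \<in> K_future M p"
    then have "V i \<subseteq> K_future M p"
      unfolding K_future_def using V(3)[of _ i] I_plus_subset_K_plus[of M]
        transD[OF trans_K_plus[of M]] by blast
    then have "x \<in> ?X interior_of K_future M p"
      using V interior_of_maximal by blast
    then show False
      using x by (simp add: frontier_of_def)
  qed
  moreover have "is_sup_in (topspace ?X) (K_plus M) (range y) x"
    unfolding is_sup_in_def
  proof (intro conjI ballI impI)
    show "x \<in> topspace ?X" by (rule xX)
    show "(q, x) \<in> K_plus M" if "q \<in> range y" for q
      using that V I_plus_subset_K_plus by blast
    fix z assume z: "z \<in> topspace ?X" "\<forall>q\<in>range y. (q, z) \<in> K_plus M"
    \<comment> \<open>The events below an upper bound \<open>z\<close> form a closed set containing
      the whole sequence, hence also its limit \<open>x\<close>.\<close>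
    have "closedin ?X {q \<in> topspace ?X. (q, z) \<in> K_plus M}"
      using z(1) by (intro closedin_K_plus_preimage) (auto intro: continuous_intros)
    then have "x \<in> {q \<in> topspace ?X. (q, z) \<in> K_plus M}"
      using y z by (intro limitin_closedin[OF y(3)]) auto
    then show "(x, z) \<in> K_plus M" by simp
  qed
  ultimately show "x \<in> causal_boundary M p"
    unfolding causal_boundary_def using xK y I_plus_subset_K_plus by blast
next
  let ?X = "events M"
  fix x assume "x \<in> causal_boundary M p"
  then obtain y :: "nat \<Rightarrow> 'a" where xK: "x \<in> K_future M p"
    and y: "range y \<subseteq> topspace ?X - K_future M p" "\<And>i. (y i, y (Suc i)) \<in> K_plus M"
    and sup: "is_sup_in (topspace ?X) (K_plus M) (range y) x"
    by (auto simp: causal_boundary_def)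
  \<comment> \<open>The sequence lies in the complement, so \<open>x\<close> is in the closure of
    the complement as well as in \<open>K_future M p\<close>.\<close>
  have "x \<in> ?X closure_of (range y)"
    using K_sup_in_closure[OF assms(1,2) y(2) sup] .
  then have "x \<in> ?X closure_of (topspace ?X - K_future M p)"
    using closure_of_mono[OF y(1)] by blast
  moreover have "x \<in> ?X closure_of K_future M p"
    using xK closedin_K_future[OF assms(3)] by (simp add: closure_of_closedin)
  ultimately show "x \<in> ?X frontier_of K_future M p"
    by (simp add: frontier_of_closures)
qed

end
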